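(* Let $(Q,\cdot)$ be a left Bol loop and let $(Q,\ast)$ be its corresponding middle Bol loop. Let $A\le AUT(Q,\cdot)$, let $(H,\odot)$ be the $A$-holomorph of $(Q,\cdot)$ and let $(H',\circledast)$ be the $A$-holomorph of $(Q,\ast)$. Then $(H,\odot)=(H',\circledast)$ if and only if $(Q,\cdot)$ is flexible.
   Context: Maps are written on the right of their arguments and composed from left to right. A left Bol loop is a loop satisfying $(x\cdot(y\cdot x))\cdot z=x\cdot(y\cdot(x\cdot z))$ for all $x,y,z$. A middle Bol loop is a loop satisfying $x((yz)\backslash x)=(x/z)(y\backslash x)$ for all $x,y,z$, where $x\backslash y$ is the unique $u$ with $xu=y$ and $x/y$ is the unique $u$ with $uy=x$. The middle Bol loop corresponding to a left Bol loop $(Q,\cdot)$ is $(Q,\ast)$ with $x\ast y=y\cdot((y^{-1}\cdot x)\cdot y)$, where $y^{-1}$ is the (two-sided) inverse of $y$ in $(Q,\cdot)$. It is known that $AUT(Q,\cdot)=AUT(Q,\ast)$. A loop is flexible if $(y\cdot a)\cdot y=y\cdot(a\cdot y)$ for all $a,y$. For a subgroup $A$ of the automorphism group, the $A$-holomorph of $(Q,\cdot)$ is the loop on $A\times Q$ with $(\alpha,x)\odot(\beta,y)=(\alpha\beta,\,x\beta\cdot y)$, and the $A$-holomorph of $(Q,\ast)$ is the loop on $A\times Q$ with $(\alpha,x)\circledast(\beta,y)=(\alpha\beta,\,x\beta\ast y)$. Equality of holomorphs means equality of underlying sets and of operations. *)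

theory Defs
  imports "HOL-Algebra.Bij"
begin

text \<open>
  Loops are HOL-Algebra monoid records. The library constants \<^const>\<open>m_inv\<close> (the two-sided
  inverse), \<^const>\<open>hom\<close> and \<^const>\<open>AutoGroup\<close> are defined for
  arbitrary such records, without assuming associativity.
\<close>

locale loop =
  fixes Q :: "('a, 'b) monoid_scheme" (structure)
  assumes m_closed [simp, intro]: "\<lbrakk>x \<in> carrier Q; y \<in> carrier Q\<rbrakk> \<Longrightarrow> x \<otimes> y \<in> carrier Q"
    and one_closed [simp, intro]: "\<one> \<in> carrier Q"
    and l_one [simp]: "x \<in> carrier Q \<Longrightarrow> \<one> \<otimes> x = x"
    and r_one [simp]: "x \<in> carrier Q \<Longrightarrow> x \<otimes> \<one> = x"
    and ldiv_ex1: "\<lbrakk>x \<in> carrier Q; y \<in> carrier Q\<rbrakk> \<Longrightarrow> \<exists>!u. u \<in> carrier Q \<and> x \<otimes> u = y"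
    and rdiv_ex1: "\<lbrakk>x \<in> carrier Q; y \<in> carrier Q\<rbrakk> \<Longrightarrow> \<exists>!u. u \<in> carrier Q \<and> u \<otimes> y = x"

locale left_bol_loop = loop +
  assumes left_bol: "\<lbrakk>x \<in> carrier Q; y \<in> carrier Q; z \<in> carrier Q\<rbrakk>
    \<Longrightarrow> (x \<otimes> (y \<otimes> x)) \<otimes> z = x \<otimes> (y \<otimes> (x \<otimes> z))"

definition ldiv :: "('a, 'b) monoid_scheme \<Rightarrow> 'a \<Rightarrow> 'a \<Rightarrow> 'a" where
  "ldiv Q x y = (THE u. u \<in> carrier Q \<and> x \<otimes>\<^bsub>Q\<^esub> u = y)"

definition rdiv :: "('a, 'b) monoid_scheme \<Rightarrow> 'a \<Rightarrow> 'a \<Rightarrow> 'a" where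
  "rdiv Q x y = (THE u. u \<in> carrier Q \<and> u \<otimes>\<^bsub>Q\<^esub> y = x)"

locale middle_bol_loop = loop +
  assumes middle_bol: "\<lbrakk>x \<in> carrier Q; y \<in> carrier Q; z \<in> carrier Q\<rbrakk>
    \<Longrightarrow> x \<otimes> ldiv Q (y \<otimes> z) x = rdiv Q x z \<otimes> ldiv Q y x"

definition flexible :: "('a, 'b) monoid_scheme \<Rightarrow> bool" where
  "flexible Q \<longleftrightarrow>
     (\<forall>a \<in> carrier Q. \<forall>y \<in> carrier Q. (y \<otimes>\<^bsub>Q\<^esub> a) \<otimes>\<^bsub>Q\<^esub> y = y \<otimes>\<^bsub>Q\<^esub> (a \<otimes>\<^bsub>Q\<^esub> y))"

definition corresponding_middle_bol :: "('a, 'b) monoid_scheme \<Rightarrow> 'a monoid" where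
  "corresponding_middle_bol Q =
     \<lparr>carrier = carrier Q,
      mult = \<lambda>x y. y \<otimes>\<^bsub>Q\<^esub> ((inv\<^bsub>Q\<^esub> y \<otimes>\<^bsub>Q\<^esub> x) \<otimes>\<^bsub>Q\<^esub> y),
      one = \<one>\<^bsub>Q\<^esub>\<rparr>"

text \<open>
  Automorphisms act on the right in the source, so the product
  \<open>\<alpha>\<beta>\<close> is ``first \<open>\<alpha>\<close>, then \<open>\<beta>\<close>'', that is
  \<^term>\<open>compose (carrier Q) \<beta> \<alpha>\<close>. This is opposite to the product of
  \<^const>\<open>AutoGroup\<close>, but a group and its opposite have the same subgroups.
\<close>

definition holomorph ::
    "('a, 'b) monoid_scheme \<Rightarrow> ('a \<Rightarrow> 'a) set \<Rightarrow> (('a \<Rightarrow> 'a) \<times> 'a) monoid" where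
  "holomorph Q A =
     \<lparr>carrier = A \<times> carrier Q,
      mult = \<lambda>(\<alpha>, x) (\<beta>, y). (compose (carrier Q) \<beta> \<alpha>, \<beta> x \<otimes>\<^bsub>Q\<^esub> y),
      one = (\<lambda>x \<in> carrier Q. x, \<one>\<^bsub>Q\<^esub>)\<rparr>"

text \<open>
  Record equality would also compare the irrelevant values of the products outside the carriers.
\<close>

definition same_structure :: "('a, 'b) monoid_scheme \<Rightarrow> ('a, 'c) monoid_scheme \<Rightarrow> bool" where
  "same_structure G H \<longleftrightarrow>
     carrier G = carrier H \<and>
     (\<forall>x \<in> carrier G. \<forall>y \<in> carrier G. x \<otimes>\<^bsub>G\<^esub> y = x \<otimes>\<^bsub>H\<^esub> y)"


context loop
begin

lemma l_cancel: "\<lbrakk>x \<otimes> u = x \<otimes> v; x \<in> carrier Q; u \<in> carrier Q; v \<in> carrier Q\<rbrakk> \<Longrightarrow> u = v"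
  using ldiv_ex1[of x "x \<otimes> v"] by auto

lemma r_cancel: "\<lbrakk>u \<otimes> x = v \<otimes> x; x \<in> carrier Q; u \<in> carrier Q; v \<in> carrier Q\<rbrakk> \<Longrightarrow> u = v"
  using rdiv_ex1[of "v \<otimes> x" x] by auto

lemma ldiv_eqI: "\<lbrakk>x \<otimes> u = y; x \<in> carrier Q; u \<in> carrier Q\<rbrakk> \<Longrightarrow> ldiv Q x y = u"
  unfolding ldiv_def by (rule the_equality) (auto intro: l_cancel)

lemma rdiv_eqI: "\<lbrakk>u \<otimes> y = x; y \<in> carrier Q; u \<in> carrier Q\<rbrakk> \<Longrightarrow> rdiv Q x y = u"
  unfolding rdiv_def by (rule the_equality) (auto intro: r_cancel)

end

context left_bol_loop
begin

lemma inverse: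
  assumes x: "x \<in> carrier Q"
  shows inv_closed: "inv x \<in> carrier Q" and r_inv: "x \<otimes> inv x = \<one>" and l_inv: "inv x \<otimes> x = \<one>"
proof -
  obtain u where u: "u \<in> carrier Q" "x \<otimes> u = \<one>"
    using ldiv_ex1[OF x one_closed] by blast
  have "x \<otimes> (u \<otimes> x) = x"
  proof (rule r_cancel)
    show "x \<otimes> (u \<otimes> x) \<otimes> u = x \<otimes> u"
      using left_bol[of x u u] x u by simp
  qed (use x u in auto)
  then have "u \<otimes> x = \<one>"
    using l_cancel[of x "u \<otimes> x" \<one>] x u by simp
  then have "inv x = u"
    unfolding m_inv_def using x u by (intro the_equality) (auto intro: l_cancel[of x])
  then show "inv x \<in> carrier Q" "x \<otimes> inv x = \<one>" "inv x \<otimes> x = \<one>"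
    using u \<open>u \<otimes> x = \<one>\<close> by auto
qed

lemma inv_inv: "x \<in> carrier Q \<Longrightarrow> inv (inv x) = x"
  by (metis inverse l_cancel)

lemma left_inverse_property:
  assumes x: "x \<in> carrier Q" and y: "y \<in> carrier Q"
  shows "inv x \<otimes> (x \<otimes> y) = y" and "x \<otimes> (inv x \<otimes> y) = y"
proof -
  have *: "inv x \<otimes> (x \<otimes> y) = y" if x: "x \<in> carrier Q" and y: "y \<in> carrier Q" for x y
  proof -
    have "x \<otimes> (inv x \<otimes> (x \<otimes> y)) = x \<otimes> y"
      using left_bol[of x "inv x" y] x y by (simp add: inverse)
    then show ?thesis
      using l_cancel[of x "inv x \<otimes> (x \<otimes> y)" y] x y by (simp add: inverse)
  qed
  show "inv x \<otimes> (x \<otimes> y) = y" "x \<otimes> (inv x \<otimes> y) = y"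
    using *[OF x y] *[of "inv x" y] x y by (simp_all add: inverse inv_inv)
qed

theorem middle_bol_loop_corresponding: "middle_bol_loop (corresponding_middle_bol Q)"
proof -
  define m where "m x y = y \<otimes> ((inv y \<otimes> x) \<otimes> y)" for x y
  let ?M = "corresponding_middle_bol Q"
  have M: "carrier ?M = carrier Q" "mult ?M = m" "one ?M = \<one>"
    by (auto simp: corresponding_middle_bol_def m_def fun_eq_iff)
  have mc: "m x y \<in> carrier Q" if "x \<in> carrier Q" "y \<in> carrier Q" for x y
    using that by (simp add: m_def inverse)
  have m_inv_r: "m x y \<otimes> inv y = x" if "x \<in> carrier Q" "y \<in> carrier Q" for x y
    using that left_bol[of y "inv y \<otimes> x" "inv y"]
    by (simp add: m_def inverse left_inverse_property)
  have m_eqI: "m x y = u" if "u \<otimes> inv y = x" "x \<in> carrier Q" "y \<in> carrier Q" "u \<in> carrier Q"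
    for x y u
    using that r_cancel[of "m x y" "inv y" u] m_inv_r[of x y] mc[of x y] by (simp add: inverse)
  have rdiv_sol: "m (x \<otimes> inv y) y = x" if "x \<in> carrier Q" "y \<in> carrier Q" for x y
    using that by (intro m_eqI) (auto simp: inverse)
  have rdiv_uniq: "u = x \<otimes> inv y" if "m u y = x" "y \<in> carrier Q" "u \<in> carrier Q" for x y u
    using that m_inv_r[of u y] by simp
  have ldiv_sol: "m x (inv (inv y \<otimes> x)) = y" if "x \<in> carrier Q" "y \<in> carrier Q" for x y
    using that by (intro m_eqI) (auto simp: inverse inv_inv left_inverse_property)
  have ldiv_uniq: "u = inv (inv y \<otimes> x)" if "m x u = y" "x \<in> carrier Q" "u \<in> carrier Q" for x y u
    using that m_inv_r[of x u] mc[of x u] left_inverse_property(1)[of y "inv u"]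
    by (auto simp: inverse inv_inv)
  have inv_one: "inv \<one> = \<one>"
    using r_inv[OF one_closed] l_one[OF inv_closed[OF one_closed]] by simp
  interpret M: loop ?M
  proof (unfold_locales, unfold M)
    fix x y assume xy: "x \<in> carrier Q" "y \<in> carrier Q"
    show "\<exists>!u. u \<in> carrier Q \<and> m x u = y"
      using xy ldiv_sol[of x y] ldiv_uniq by (intro ex1I[of _ "inv (inv y \<otimes> x)"]) (auto simp: inverse)
    show "\<exists>!u. u \<in> carrier Q \<and> m u y = x"
      using xy rdiv_sol[of x y] rdiv_uniq by (intro ex1I[of _ "x \<otimes> inv y"]) (auto simp: inverse)
  qed (auto simp: mc m_def inverse inv_one)
  have ldiv_M: "ldiv ?M x y = inv (inv y \<otimes> x)" if "x \<in> carrier Q" "y \<in> carrier Q" for x y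
    using that by (intro M.ldiv_eqI[unfolded M] ldiv_sol) (auto simp: inverse)
  have rdiv_M: "rdiv ?M x y = x \<otimes> inv y" if "x \<in> carrier Q" "y \<in> carrier Q" for x y
    using that by (intro M.rdiv_eqI[unfolded M] rdiv_sol) (auto simp: inverse)
  show ?thesis
  proof (unfold_locales, unfold M)
    fix x y z assume xyz: "x \<in> carrier Q" "y \<in> carrier Q" "z \<in> carrier Q"
    define P where "P = m y z"
    define t where "t = inv x \<otimes> P"
    define u where "u = m x (inv t)"
    have P: "P \<in> carrier Q" and t: "t \<in> carrier Q" and u: "u \<in> carrier Q"
      using xyz by (auto simp: P_def t_def u_def mc inverse)
    have y: "y = P \<otimes> inv z"
      using m_inv_r[of y z] xyz by (simp add: P_def)
    have P_eq: "P = x \<otimes> t"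
      using xyz P by (simp add: t_def left_inverse_property)
    have ut: "u \<otimes> t = x"
      using m_inv_r[of x "inv t"] xyz t by (simp add: u_def inverse inv_inv)
    have inv_u: "inv x \<otimes> ((x \<otimes> t) \<otimes> inv x) = inv u"
    proof (rule r_cancel[of _ x])
      have "(inv x \<otimes> ((x \<otimes> t) \<otimes> inv x)) \<otimes> x = t"
        using left_bol[of "inv x" "x \<otimes> t" x] xyz t
        by (simp add: inverse left_inverse_property)
      also have "t = inv u \<otimes> x"
        using left_inverse_property(1)[OF u t] by (simp add: ut)
      finally show "(inv x \<otimes> ((x \<otimes> t) \<otimes> inv x)) \<otimes> x = inv u \<otimes> x" .
    qed (use xyz t u in \<open>auto simp: inverse\<close>)
    have "inv u \<otimes> (x \<otimes> inv z) = inv x \<otimes> (P \<otimes> inv z)"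
      using left_bol[of "inv x" "x \<otimes> t" "x \<otimes> inv z"] xyz t
      by (simp add: inverse left_inverse_property inv_u P_eq)
    then have "u \<otimes> (inv x \<otimes> y) = x \<otimes> inv z"
      using left_inverse_property(2)[of u "x \<otimes> inv z"] xyz u by (simp add: y inverse)
    then have "m (x \<otimes> inv z) (inv (inv x \<otimes> y)) = u"
      using xyz u by (intro m_eqI) (auto simp: inverse inv_inv)
    then show "m x (ldiv ?M (m y z) x) = m (rdiv ?M x z) (ldiv ?M y x)"
      using xyz P by (simp add: ldiv_M rdiv_M P_def[symmetric] t_def[symmetric] u_def)
  qed
qed

end

end

theory Submission
  imports Defs
begin

text \<open>Two facts combine. Since \<open>A\<close> contains the identity automorphism, the loop
  product can be read off from the holomorph; so the holomorphs agree exactly when \<open>x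
  \<otimes> y = y \<otimes> ((inv y \<otimes> x) \<otimes> y)\<close> throughout \<open>Q\<close>
  (\<open>same_structure_holomorph_iff\<close>). Writing \<open>x = y \<otimes> a\<close>, that is,
  \<open>a = inv y \<otimes> x\<close> by the left inverse property of left Bol loops, turns this
  identity into the flexible law (\<open>flexible_iff_same_mult_middle_bol\<close>).\<close>

lemma (in left_bol_loop) flexible_iff_same_mult_middle_bol:
  "flexible Q \<longleftrightarrow>
    (\<forall>x \<in> carrier Q. \<forall>y \<in> carrier Q. x \<otimes> y = y \<otimes> ((inv y \<otimes> x) \<otimes> y))"
proof
  assume flex: "flexible Q"
  show "\<forall>x \<in> carrier Q. \<forall>y \<in> carrier Q. x \<otimes> y = y \<otimes> ((inv y \<otimes> x) \<otimes> y)"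
  proof (intro ballI)
    fix x y assume xy: "x \<in> carrier Q" "y \<in> carrier Q"
    \<comment> \<open>The flexible law at \<open>a = inv y \<otimes> x\<close>, chosen so that
      \<open>y \<otimes> a\<close> collapses to \<open>x\<close>.\<close>
    then have "(y \<otimes> (inv y \<otimes> x)) \<otimes> y = y \<otimes> ((inv y \<otimes> x) \<otimes> y)"
      using flex by (simp add: flexible_def inverse)
    with xy show "x \<otimes> y = y \<otimes> ((inv y \<otimes> x) \<otimes> y)"
      by (simp add: left_inverse_property)
  qed
next
  assume same: "\<forall>x \<in> carrier Q. \<forall>y \<in> carrier Q. x \<otimes> y = y \<otimes> ((inv y \<otimes> x) \<otimes> y)"
  show "flexible Q"
    unfolding flexible_def
  proof (intro ballI)
    fix a y assume ay: "a \<in> carrier Q" "y \<in> carrier Q"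
    \<comment> \<open>The inverse substitution: \<open>same\<close> with
      \<open>y \<otimes> a\<close> in place of \<open>x\<close>.\<close>
    then have "(y \<otimes> a) \<otimes> y = y \<otimes> ((inv y \<otimes> (y \<otimes> a)) \<otimes> y)"
      using same by blast
    with ay show "(y \<otimes> a) \<otimes> y = y \<otimes> (a \<otimes> y)"
      by (simp add: left_inverse_property)
  qed
qed

text \<open>Pairs whose first component is the identity multiply as in the loop, which gives the
  forward direction. Conversely, \<open>maps\<close> is what allows the two products to be compared
  at \<open>\<beta> x\<close>, and equal carriers make the two restricted compositions
  coincide.\<close>

lemma same_structure_holomorph_iff:
  assumes carrier_eq: "carrier G = carrier H"
    and id_in: "(\<lambda>x \<in> carrier G. x) \<in> A"
    and maps: "\<And>\<beta> x. \<beta> \<in> A \<Longrightarrow> x \<in> carrier G \<Longrightarrow> \<beta> x \<in> carrier G"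
  shows "same_structure (holomorph G A) (holomorph H A) \<longleftrightarrow> same_structure G H"
proof
  assume same: "same_structure (holomorph G A) (holomorph H A)"
  let ?i = "\<lambda>x \<in> carrier G. x"
  have "x \<otimes>\<^bsub>G\<^esub> y = x \<otimes>\<^bsub>H\<^esub> y" if xy: "x \<in> carrier G" "y \<in> carrier G" for x y
  proof -
    have "(?i, x) \<in> carrier (holomorph G A)" "(?i, y) \<in> carrier (holomorph G A)"
      using xy id_in by (simp_all add: holomorph_def)
    with same have "(?i, x) \<otimes>\<^bsub>holomorph G A\<^esub> (?i, y) = (?i, x) \<otimes>\<^bsub>holomorph H A\<^esub> (?i, y)"
      unfolding same_structure_def by blast
    with xy show ?thesis
      by (simp add: holomorph_def)
  qed
  with carrier_eq show "same_structure G H"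
    by (simp add: same_structure_def)
next
  assume "same_structure G H"
  then show "same_structure (holomorph G A) (holomorph H A)"
    using maps by (auto simp: same_structure_def holomorph_def)
qed

theorem theorem2p5:
  fixes Q :: "('a, 'b) monoid_scheme"
    and A :: "('a \<Rightarrow> 'a) set"
  assumes "left_bol_loop Q"
    and "subgroup A (AutoGroup Q)"
  shows "same_structure (holomorph Q A) (holomorph (corresponding_middle_bol Q) A)
    \<longleftrightarrow> flexible Q"
proof -
  interpret left_bol_loop Q by fact
  have "(\<lambda>x \<in> carrier Q. x) \<in> A"
    \<comment> \<open>The unit of \<open>AutoGroup Q\<close> is the identity restricted to the
      carrier, the same function as the one required by \<open>id_in\<close>.\<close>
    using subgroup.one_closed[OF assms(2)] by (simp add: AutoGroup_def BijGroup_def)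
  moreover have "\<beta> x \<in> carrier Q" if "\<beta> \<in> A" "x \<in> carrier Q" for \<beta> x
    using subgroup.subset[OF assms(2)] that by (auto simp: AutoGroup_def auto_def hom_def)
  ultimately have "same_structure (holomorph Q A) (holomorph (corresponding_middle_bol Q) A)
      \<longleftrightarrow> same_structure Q (corresponding_middle_bol Q)"
    by (intro same_structure_holomorph_iff) (simp_all add: corresponding_middle_bol_def)
  then show ?thesis
    by (simp add: same_structure_def corresponding_middle_bol_def flexible_iff_same_mult_middle_bol)
qed

end
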